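(* Let $X$ be a Banach space and let $T$ be a bounded linear operator on $X$. If $T$ can be embedded into a $C_0$-semigroup on $X$, then each of the two quantities $\dim(\ker T)$ and $\operatorname{codim}(\operatorname{rg} T)$ is equal to zero or to infinity.
   Context: A linear operator $T$ on a Banach space $X$ can be embedded into a $C_0$-semigroup (is embeddable) if there exists a $C_0$-semigroup (strongly continuous one-parameter semigroup of bounded linear operators) $(T(t))_{t\ge 0}$ on $X$ such that $T=T(1)$. Here $\ker T$ is the kernel of $T$, $\operatorname{rg} T$ is its range, and $\operatorname{codim}(\operatorname{rg} T)=\dim (X/\operatorname{rg} T)$. A dimension "equal to infinity" means that it is not finite. *)

theory Defs
  imports "HOL-Analysis.Analysis"
begin

text \<open>
  A Banach space over the scalar field \<open>'k\<close>. The class \<open>banach\<close> already supplies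
  a complete norm and the multiplication by real scalars; \<open>scl\<close> is a multiplication
  by elements of \<open>'k\<close> that extends it. Up to isometric isomorphism, the only fields of sort
  \<open>{real_normed_field, euclidean_space}\<close> are \<open>real\<close> and \<open>complex\<close>, so that
  real and complex Banach spaces are treated at once.
\<close>

locale banach_space = vector_space scl
  for scl :: "'k::{real_normed_field, euclidean_space} \<Rightarrow> 'a::banach \<Rightarrow> 'a" +
  assumes scale_of_real: "scl (of_real r) x = r *\<^sub>R x"
    and norm_scale: "norm (scl c x) = norm c * norm x"

lemma banach_space_real: "banach_space ((*\<^sub>R) :: real \<Rightarrow> 'a::banach \<Rightarrow> 'a)"
  by unfold_locales (auto simp: algebra_simps)

lemma banach_space_complex: "banach_space ((*) :: complex \<Rightarrow> complex \<Rightarrow> complex)"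
  by unfold_locales (auto simp: algebra_simps scaleR_conv_of_real norm_mult)

definition bounded_operator ::
    "('k::{real_normed_field, euclidean_space} \<Rightarrow> 'a::banach \<Rightarrow> 'a) \<Rightarrow> ('a \<Rightarrow> 'a) \<Rightarrow> bool"
  where "bounded_operator scl T \<longleftrightarrow>
    Vector_Spaces.linear scl scl T \<and> (\<exists>K. \<forall>x. norm (T x) \<le> norm x * K)"

text \<open>Only the values \<open>S t\<close> with \<open>t \<ge> 0\<close> matter.\<close>

definition C0_semigroup ::
    "('k::{real_normed_field, euclidean_space} \<Rightarrow> 'a::banach \<Rightarrow> 'a) \<Rightarrow> (real \<Rightarrow> 'a \<Rightarrow> 'a) \<Rightarrow> bool"
  where "C0_semigroup scl S \<longleftrightarrow>
    (\<forall>t\<ge>0. bounded_operator scl (S t)) \<and>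
    S 0 = id \<and>
    (\<forall>s\<ge>0. \<forall>t\<ge>0. S (s + t) = S s \<circ> S t) \<and>
    (\<forall>x. continuous_on {0..} (\<lambda>t. S t x))"

definition embeddable ::
    "('k::{real_normed_field, euclidean_space} \<Rightarrow> 'a::banach \<Rightarrow> 'a) \<Rightarrow> ('a \<Rightarrow> 'a) \<Rightarrow> bool"
  where "embeddable scl T \<longleftrightarrow> (\<exists>S. C0_semigroup scl S \<and> T = S 1)"

text \<open>
  The library's \<open>dim\<close> is \<open>nat\<close>-valued and \<open>0\<close> on spaces without finite basis;
  here these get dimension \<open>\<infinity>\<close>. The argument \<open>V\<close> is meant to be a subspace.
\<close>

definition edim :: "('k::field \<Rightarrow> 'a::ab_group_add \<Rightarrow> 'a) \<Rightarrow> 'a set \<Rightarrow> enat"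
  where "edim scl V =
    (if \<exists>B. finite B \<and> V \<subseteq> module.span scl B then enat (vector_space.dim scl V) else \<infinity>)"

text \<open>
  The quotient of the whole space by a subspace \<open>Y\<close> is the set of cosets \<open>x +o Y\<close>.
  Cosets are added as sets, with zero element \<open>Y\<close>. In the scalar multiple,
  \<open>Y\<close> is added so that \<open>0\<close> times a coset is \<open>Y\<close> and not \<open>{0}\<close>;
  in the linear combination, so that the empty one is \<open>Y\<close>.
\<close>

definition quotient_space :: "'a::ab_group_add set \<Rightarrow> 'a set set"
  where "quotient_space Y = range (\<lambda>x. x +o Y)"

definition quotient_scale ::
    "('k::field \<Rightarrow> 'a::ab_group_add \<Rightarrow> 'a) \<Rightarrow> 'a set \<Rightarrow> 'k \<Rightarrow> 'a set \<Rightarrow> 'a set"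
  where "quotient_scale scl Y c A = scl c ` A + Y"

definition quotient_lincomb ::
    "('k::field \<Rightarrow> 'a::ab_group_add \<Rightarrow> 'a) \<Rightarrow> 'a set \<Rightarrow> 'a set set \<Rightarrow> ('a set \<Rightarrow> 'k) \<Rightarrow> 'a set"
  where "quotient_lincomb scl Y F u = Y + (\<Sum>A\<in>F. quotient_scale scl Y (u A) A)"

definition quotient_basis ::
    "('k::field \<Rightarrow> 'a::ab_group_add \<Rightarrow> 'a) \<Rightarrow> 'a set \<Rightarrow> 'a set set \<Rightarrow> bool"
  where "quotient_basis scl Y B \<longleftrightarrow>
    B \<subseteq> quotient_space Y \<and>
    (\<forall>F u. finite F \<and> F \<subseteq> B \<and> quotient_lincomb scl Y F u = Y \<longrightarrow> (\<forall>A\<in>F. u A = 0)) \<and>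
    (\<forall>C\<in>quotient_space Y. \<exists>F u. finite F \<and> F \<subseteq> B \<and> C = quotient_lincomb scl Y F u)"

definition codim :: "('k::field \<Rightarrow> 'a::ab_group_add \<Rightarrow> 'a) \<Rightarrow> 'a set \<Rightarrow> enat"
  where "codim scl Y =
    (if \<exists>B. finite B \<and> quotient_basis scl Y B
     then enat (card (SOME B. finite B \<and> quotient_basis scl Y B)) else \<infinity>)"

context vector_space
begin

lemma coset_plus:
  assumes "subspace Y"
  shows "(x +o Y) + (y +o Y) = (x + y) +o Y"
proof -
  have "Y + Y = Y"
    using subspace_0[OF assms] subspace_add[OF assms] unfolding set_plus_def by force
  then show ?thesis
    by (metis set_plus_rearrange)
qed

lemma quotient_scale_coset:
  assumes "subspace Y"
  shows "quotient_scale scale Y c (x +o Y) = scale c x +o Y"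
proof (intro equalityI subsetI)
  fix z assume "z \<in> quotient_scale scale Y c (x +o Y)"
  then obtain y y' where "y \<in> Y" "y' \<in> Y" "z = scale c (x + y) + y'"
    by (auto simp: quotient_scale_def set_plus_def elt_set_plus_def)
  moreover from this have "scale c y + y' \<in> Y"
    using assms by (simp add: subspace_add subspace_scale)
  ultimately show "z \<in> scale c x +o Y"
    by (auto simp: elt_set_plus_def scale_right_distrib add.assoc)
next
  fix z assume "z \<in> scale c x +o Y"
  moreover have "x \<in> x +o Y"
    using subspace_0[OF assms] by (force simp: elt_set_plus_def)
  ultimately show "z \<in> quotient_scale scale Y c (x +o Y)"
    by (auto simp: quotient_scale_def set_plus_def elt_set_plus_def)
qed

lemma quotient_lincomb_cosets:
  assumes Y: "subspace Y" and F: "finite F" and rep: "\<And>A. A \<in> F \<Longrightarrow> A = r A +o Y"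
  shows "quotient_lincomb scale Y F u = (\<Sum>A\<in>F. scale (u A) (r A)) +o Y"
proof -
  have "Y + (\<Sum>A\<in>F. quotient_scale scale Y (u A) A) = (\<Sum>A\<in>F. scale (u A) (r A)) +o Y"
    using F rep
  proof (induction F)
    case empty
    then show ?case by (simp add: elt_set_plus_def)
  next
    case (insert A F)
    have "A = r A +o Y"
      using insert.prems by blast
    then have A: "quotient_scale scale Y (u A) A = scale (u A) (r A) +o Y"
      using quotient_scale_coset[OF Y, of "u A" "r A"] by simp
    have IH: "Y + (\<Sum>A\<in>F. quotient_scale scale Y (u A) A) = (\<Sum>A\<in>F. scale (u A) (r A)) +o Y"
      by (rule insert.IH) (use insert.prems in blast)
    have "Y + (\<Sum>A\<in>insert A F. quotient_scale scale Y (u A) A) =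
        quotient_scale scale Y (u A) A + (Y + (\<Sum>A\<in>F. quotient_scale scale Y (u A) A))"
      unfolding sum.insert[OF insert.hyps] by (rule add.left_commute)
    then show ?case
      unfolding A IH coset_plus[OF Y] sum.insert[OF insert.hyps] .
  qed
  then show ?thesis by (simp add: quotient_lincomb_def)
qed

end

end

theory Submission
  imports Defs
begin

text \<open>
  Kernel: if \<open>ker S(1)\<close> is finite-dimensional, then the decreasing spaces \<open>ker S(t)\<close> are constant
  for small \<open>t > 0\<close>, and strong continuity at \<open>0\<close> forces the common value to be zero.

  Range: the union \<open>Z\<close> of the ranges \<open>rg S(t)\<close>, \<open>t > 0\<close>, is a dense subspace. A dense subspace
  containing the finite-codimensional range of a bounded operator is the whole space, so \<open>Z = X\<close>.
  Hence a finite set spanning a complement of \<open>rg S(1)\<close> lies in a single \<open>rg S(t)\<close>, so that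
  \<open>S(t)\<close>, and therefore \<open>S(1)\<close>, is surjective.

  The density statement is a form of the open mapping theorem. Instead of a domain depending on the
  number of complementary dimensions, it uses sets \<open>C\<close> closed under the infinite convex combinations
  \<open>\<Sum> 2\<^sup>-\<^sup>n z\<^sub>n\<close>: by Baire's theorem, such a set contains a ball if it is symmetric and absorbing.
\<close>

section \<open>Sigma-convex sets and Baire category\<close>

definition sigma_convex :: "'a::real_normed_vector set \<Rightarrow> bool"
  where "sigma_convex C \<longleftrightarrow>
    (\<forall>z. range z \<subseteq> C \<longrightarrow> (\<exists>y\<in>C. (\<lambda>n. (1/2) ^ Suc n *\<^sub>R z n) sums y))"

text \<open>The weights add up to 1, so the series converges absolutely and stays in the unit ball.
  This serves both for vectors and for scalar coefficients.\<close>

lemma half_powers_sums_bounded: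
  fixes z :: "nat \<Rightarrow> 'a::banach"
  assumes "\<And>n. norm (z n) \<le> 1"
  obtains y where "(\<lambda>n. (1/2) ^ Suc n *\<^sub>R z n) sums y" "norm y \<le> 1"
proof -
  have le: "norm ((1/2) ^ Suc n *\<^sub>R z n) \<le> (1/2) ^ Suc n" for n
    using mult_left_mono[OF assms[of n], of "(1/2) ^ Suc n"] by simp
  have sm: "summable (\<lambda>n. norm ((1/2) ^ Suc n *\<^sub>R z n))"
    by (rule summable_comparison_test[OF _ sums_summable[OF power_half_series]]) (use le in auto)
  have "norm (\<Sum>n. (1/2) ^ Suc n *\<^sub>R z n) \<le> (\<Sum>n. (1/2) ^ Suc n)"
    by (rule order_trans[OF summable_norm[OF sm]])
       (rule suminf_le[OF le sm sums_summable[OF power_half_series]])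
  then have "norm (\<Sum>n. (1/2) ^ Suc n *\<^sub>R z n) \<le> 1"
    using sums_unique[OF power_half_series] by simp
  moreover have "(\<lambda>n. (1/2) ^ Suc n *\<^sub>R z n) sums (\<Sum>n. (1/2) ^ Suc n *\<^sub>R z n)"
    using summable_norm_cancel[OF sm] by (rule summable_sums)
  ultimately show thesis using that by blast
qed

text \<open>Apply sigma-convexity to the sequence \<open>a, b, b, ...\<close>: the first weight is
  1/2 and the remaining ones add up to 1/2.\<close>

lemma sigma_convex_midpoint:
  assumes "sigma_convex C" "a \<in> C" "b \<in> C"
  shows "(1/2) *\<^sub>R (a + b) \<in> C"
proof -
  define z where "z n = (if n = 0 then a else b)" for n :: nat
  obtain y where y: "y \<in> C" "(\<lambda>n. (1/2) ^ Suc n *\<^sub>R z n) sums y"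
    using assms unfolding sigma_convex_def by (metis (mono_tags) z_def image_subsetI)
  have "(\<lambda>n. (1/2) ^ Suc n *\<^sub>R b + (if n = 0 then (1/2) *\<^sub>R (a - b) else 0)) sums
      (1 *\<^sub>R b + (1/2) *\<^sub>R (a - b))"
    using sums_add[OF bounded_linear.sums[OF bounded_linear_scaleR_left power_half_series]
        sums_single[of 0 "\<lambda>_. (1/2) *\<^sub>R (a - b)"]] by simp
  moreover have "(\<lambda>n. (1/2) ^ Suc n *\<^sub>R b + (if n = 0 then (1/2) *\<^sub>R (a - b) else 0)) =
      (\<lambda>n. (1/2) ^ Suc n *\<^sub>R z n)"
    by (auto simp: z_def algebra_simps)
  moreover have "1 *\<^sub>R b + (1/2) *\<^sub>R (a - b) = (1/2) *\<^sub>R (a + b)"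
    using scaleR_left_distrib[of "1/2" "1/2" b] by (simp add: algebra_simps)
  ultimately show ?thesis
    using y sums_unique2 by metis
qed

text \<open>Successive approximation with errors halved at each step, as in the open mapping theorem.\<close>

lemma sigma_convex_ball:
  fixes C :: "'a::real_normed_vector set"
  assumes C: "sigma_convex C" and r: "ball 0 r \<subseteq> closure C"
  shows "ball 0 (r / 2) \<subseteq> C"
proof
  fix x :: 'a assume "x \<in> ball 0 (r / 2)"
  then have y0: "2 *\<^sub>R x \<in> ball 0 r"
    by simp
  then have "r > 0"
    using norm_ge_zero le_less_trans by (metis mem_ball_0)
  have "\<exists>z\<in>C. norm (y - z) < r / 2" if "y \<in> ball 0 r" for y
    using that r \<open>r > 0\<close> unfolding closure_approachable
    by (metis dist_commute dist_norm half_gt_zero subset_eq closure_approachable)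
  then obtain f where f: "\<And>y. y \<in> ball 0 r \<Longrightarrow> f y \<in> C \<and> norm (y - f y) < r / 2"
    by metis
  \<comment> \<open>\<open>y n\<close> is the remainder after \<open>n\<close> terms, magnified by
    the factor 2 to the power \<open>Suc n\<close>. The weights begin with 1/2, so the start is
    \<open>2 *\<^sub>R x\<close>; this is where the radius is halved.\<close>
  define y where "y n = ((\<lambda>v. 2 *\<^sub>R (v - f v)) ^^ n) (2 *\<^sub>R x)" for n
  have y_Suc: "y (Suc n) = 2 *\<^sub>R (y n - f (y n))" for n
    by (simp add: y_def)
  have y: "y n \<in> ball 0 r" for n
  proof (induction n)
    case 0
    then show ?case using y0 by (simp add: y_def)
  next
    case (Suc n)
    then show ?case using f[OF Suc] by (simp add: y_Suc)
  qed
  have partial: "(\<Sum>k<n. (1/2) ^ Suc k *\<^sub>R f (y k)) = x - (1/2) ^ Suc n *\<^sub>R y n" for n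
  proof (induction n)
    case 0
    then show ?case by (simp add: y_def)
  next
    case (Suc n)
    then show ?case by (simp add: y_Suc algebra_simps)
  qed
  have "(\<lambda>n. (1/2) ^ Suc n *\<^sub>R y n) \<longlonglongrightarrow> 0"
  proof (rule Lim_null_comparison)
    show "\<forall>\<^sub>F n in sequentially. norm ((1/2) ^ Suc n *\<^sub>R y n) \<le> (1/2) ^ Suc n * r"
      using y by (intro always_eventually allI) (auto simp: less_imp_le)
    show "(\<lambda>n. (1/2::real) ^ Suc n * r) \<longlonglongrightarrow> 0"
      by (intro tendsto_mult_left_zero LIMSEQ_Suc LIMSEQ_power_zero) simp
  qed
  then have "(\<lambda>n. \<Sum>k<n. (1/2) ^ Suc k *\<^sub>R f (y k)) \<longlonglongrightarrow> x"
    unfolding partial using tendsto_diff[OF tendsto_const, of _ 0 sequentially x] by fastforce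
  then have "(\<lambda>n. (1/2) ^ Suc n *\<^sub>R f (y n)) sums x"
    by (simp add: sums_def)
  moreover obtain x' where "x' \<in> C" "(\<lambda>n. (1/2) ^ Suc n *\<^sub>R f (y n)) sums x'"
    using C f y unfolding sigma_convex_def by (metis image_subsetI)
  ultimately show "x \<in> C"
    using sums_unique2 by blast
qed

text \<open>Closures of the positive integer multiples of \<open>C\<close> cover the space, so by
  Baire one of them contains a ball. Symmetry and midpoints move this ball to the origin, and
  successive approximation then removes the closure.\<close>

lemma sigma_convex_absorbing_ball:
  fixes C :: "'a::banach set"
  assumes C: "sigma_convex C" and minus: "\<And>x. x \<in> C \<Longrightarrow> - x \<in> C"
    and absorbing: "\<And>x. \<exists>n::nat. \<exists>z\<in>C. n > 0 \<and> x = real n *\<^sub>R z"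
  obtains r where "r > 0" "ball 0 r \<subseteq> C"
proof -
  define G where "G n = closure ((*\<^sub>R) (real (Suc n)) ` C)" for n
  have "\<exists>n. interior (G n) \<noteq> {}"
  proof (rule ccontr)
    assume "\<not> (\<exists>n. interior (G n) \<noteq> {})"
    then have "euclidean interior_of \<Union>(range G) = {}"
      by (intro Baire_category_alt)
         (auto simp: completely_metrizable_space_euclidean G_def)
    moreover have "\<Union>(range G) = UNIV"
    proof (intro equalityI subset_UNIV subsetI)
      fix x :: 'a
      obtain n z where "z \<in> C" "n > 0" "x = real n *\<^sub>R z"
        using absorbing by metis
      \<comment> \<open>\<open>G\<close> is indexed from 0 but scales by \<open>Suc\<close>, hence
        the shift.\<close>
      then have "x \<in> G (n - 1)"
        unfolding G_def by (intro closure_subset[THEN subsetD]) auto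
      then show "x \<in> \<Union>(range G)" by blast
    qed
    ultimately show False by simp
  qed
  then obtain n where "interior (G n) \<noteq> {}" by blast
  then obtain y e where e: "e > 0" "ball y e \<subseteq> G n"
    by (meson equals0I mem_interior)
  define m where "m = real (Suc n)"
  have m: "m > 0" by (simp add: m_def)
  have G: "v \<in> G n \<longleftrightarrow> (1 / m) *\<^sub>R v \<in> closure C" for v
  proof -
    have "G n = (*\<^sub>R) m ` closure C"
      by (simp add: G_def m_def flip: closure_scaleR)
    then show ?thesis
      using m by (auto simp: image_iff intro!: bexI[of _ "(1/m) *\<^sub>R v"])
  qed
  have closure_minus: "- v \<in> closure C" if v: "v \<in> closure C" for v
  proof -
    obtain f where "\<And>k. f k \<in> C" "f \<longlonglongrightarrow> v"
      using v unfolding closure_sequential by metis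
    then show ?thesis
      unfolding closure_sequential using minus
      by (intro exI[of _ "\<lambda>k. - f k"]) (auto intro!: tendsto_intros)
  qed
  have closure_midpoint: "(1/2) *\<^sub>R (u + v) \<in> closure C" if uv: "u \<in> closure C" "v \<in> closure C" for u v
  proof -
    obtain f g where "\<And>k. f k \<in> C" "f \<longlonglongrightarrow> u" "\<And>k. g k \<in> C" "g \<longlonglongrightarrow> v"
      using uv unfolding closure_sequential by metis
    then show ?thesis
      unfolding closure_sequential using sigma_convex_midpoint[OF C]
      by (intro exI[of _ "\<lambda>k. (1/2) *\<^sub>R (f k + g k)"]) (auto intro!: tendsto_intros)
  qed
  have "ball 0 (e / m) \<subseteq> closure C"
  proof
    fix u :: 'a assume "u \<in> ball 0 (e / m)"
    then have u: "norm (m *\<^sub>R u) < e"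
      using m by (simp add: field_simps)
    then have "y + m *\<^sub>R u \<in> G n" "y - m *\<^sub>R u \<in> G n"
      using e by (auto simp: dist_norm subset_iff)
    then have "(1/m) *\<^sub>R y + u \<in> closure C" "(1/m) *\<^sub>R y - u \<in> closure C"
      using m by (auto simp: G algebra_simps)
    \<comment> \<open>Reflecting the second point makes the centre \<open>y\<close> cancel in the
      midpoint, which leaves \<open>u\<close>.\<close>
    then have "(1/2) *\<^sub>R (((1/m) *\<^sub>R y + u) + - ((1/m) *\<^sub>R y - u)) \<in> closure C"
      by (intro closure_midpoint closure_minus)
    moreover have "(1/2) *\<^sub>R (((1/m) *\<^sub>R y + u) + - ((1/m) *\<^sub>R y - u)) = u"
      using scaleR_left_distrib[of "1/2" "1/2" u] by (simp add: algebra_simps)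
    ultimately show "u \<in> closure C" by simp
  qed
  from sigma_convex_ball[OF C this] show thesis
    using e m by (intro that[of "e / m / 2"]) auto
qed

section \<open>Finite extensions of operator ranges\<close>

context banach_space
begin

lemma bounded_linear_operator:
  assumes "bounded_operator scl A"
  shows "bounded_linear A"
proof -
  interpret A: Vector_Spaces.linear scl scl A
    using assms by (simp add: bounded_operator_def)
  obtain K where "\<And>x. norm (A x) \<le> norm x * K"
    using assms by (auto simp: bounded_operator_def)
  then show ?thesis
    by (intro bounded_linear_intro) (auto simp: A.add A.scale simp flip: scale_of_real)
qed

lemma bounded_linear_scale_left: "bounded_linear (\<lambda>c. scl c x)"
proof (rule bounded_linear_intro)
  show "scl (r *\<^sub>R c) x = r *\<^sub>R scl c x" for r c
    by (simp add: scaleR_conv_of_real flip: scale_of_real)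
qed (auto simp: scale_left_distrib norm_scale)

lemma scale_scaleR_left: "scl (r *\<^sub>R c) x = r *\<^sub>R scl c x"
  by (rule linear_simps(5)[OF bounded_linear_scale_left])

lemma span_range_operator_Un_finite:
  assumes A: "bounded_operator scl A" and R: "finite R"
  shows "span (range A \<union> R) = {A x + (\<Sum>r\<in>R. scl (c r) r) |x c. True}"
proof -
  interpret A: Vector_Spaces.linear scl scl A
    using A by (simp add: bounded_operator_def)
  have "subspace (range A)"
    by (rule A.subspace_image[OF subspace_UNIV])
  then have span_A: "span (range A) = range A" by (rule span_eq_iff[THEN iffD2])
  show ?thesis
    unfolding span_Un span_finite[OF R] span_A by auto
qed

text \<open>The image of the unit ball of the product of the space with \<open>R\<close> many copies of the scalar
  field under the map that is \<open>A\<close> on the first factor.\<close>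

definition operator_body :: "('a \<Rightarrow> 'a) \<Rightarrow> 'a set \<Rightarrow> 'a set"
  where "operator_body A R =
    {A x + (\<Sum>r\<in>R. scl (c r) r) |x c. norm x \<le> 1 \<and> (\<forall>r\<in>R. norm (c r) \<le> 1)}"

text \<open>The series is summed upstairs: arguments and coefficients converge within their unit
  balls, as the space and the scalar field are complete, and continuity carries the sums to the
  image.\<close>

lemma sigma_convex_operator_body:
  assumes A: "bounded_operator scl A"
  shows "sigma_convex (operator_body A R)"
  unfolding sigma_convex_def
proof (intro allI impI)
  fix z :: "nat \<Rightarrow> 'a"
  assume "range z \<subseteq> operator_body A R"
  then have "\<forall>n. \<exists>x c. z n = A x + (\<Sum>r\<in>R. scl (c r) r) \<and> norm x \<le> 1 \<and> (\<forall>r\<in>R. norm (c r) \<le> 1)"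
    by (force simp: operator_body_def)
  then obtain x c where z: "\<And>n. z n = A (x n) + (\<Sum>r\<in>R. scl (c n r) r)"
      and x: "\<And>n. norm (x n) \<le> 1" and c: "\<And>n r. r \<in> R \<Longrightarrow> norm (c n r) \<le> 1"
    by metis
  obtain x' where x': "(\<lambda>n. (1/2) ^ Suc n *\<^sub>R x n) sums x'" "norm x' \<le> 1"
    using half_powers_sums_bounded[OF x] .
  have "\<exists>b. (\<lambda>n. (1/2) ^ Suc n *\<^sub>R c n r) sums b \<and> norm b \<le> 1" if "r \<in> R" for r
    using half_powers_sums_bounded[of "\<lambda>n. c n r"] c[OF that] by metis
  then obtain c' where c': "\<And>r. r \<in> R \<Longrightarrow> (\<lambda>n. (1/2) ^ Suc n *\<^sub>R c n r) sums c' r"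
      "\<And>r. r \<in> R \<Longrightarrow> norm (c' r) \<le> 1"
    by metis
  have A': "bounded_linear A"
    by (rule bounded_linear_operator[OF A])
  have "(\<lambda>n. A ((1/2) ^ Suc n *\<^sub>R x n) + (\<Sum>r\<in>R. scl ((1/2) ^ Suc n *\<^sub>R c n r) r)) sums
      (A x' + (\<Sum>r\<in>R. scl (c' r) r))"
    by (intro sums_add sums_sum bounded_linear.sums[OF A']
        bounded_linear.sums[OF bounded_linear_scale_left] x' c')
  moreover have "A ((1/2) ^ Suc n *\<^sub>R x n) + (\<Sum>r\<in>R. scl ((1/2) ^ Suc n *\<^sub>R c n r) r) =
      (1/2) ^ Suc n *\<^sub>R z n" for n
    by (simp only: z scale_scaleR_left linear_simps(5)[OF A'] scaleR_right_distrib scaleR_sum_right)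
  ultimately have "(\<lambda>n. (1/2) ^ Suc n *\<^sub>R z n) sums (A x' + (\<Sum>r\<in>R. scl (c' r) r))"
    by simp
  then show "\<exists>y\<in>operator_body A R. (\<lambda>n. (1/2) ^ Suc n *\<^sub>R z n) sums y"
    by (rule bexI) (use x' c' in \<open>auto simp: operator_body_def\<close>)
qed

lemma operator_body_minus:
  assumes A: "bounded_operator scl A" and z: "z \<in> operator_body A R"
  shows "- z \<in> operator_body A R"
proof -
  obtain x c where "z = A x + (\<Sum>r\<in>R. scl (c r) r)" "norm x \<le> 1" "\<forall>r\<in>R. norm (c r) \<le> 1"
    using z by (auto simp: operator_body_def)
  then show ?thesis
    unfolding operator_body_def
    by (intro CollectI exI[of _ "- x"] exI[of _ "\<lambda>r. - c r"])
       (auto simp: linear_simps(4)[OF bounded_linear_operator[OF A]] sum_negf)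
qed

lemma operator_body_absorbing:
  assumes A: "bounded_operator scl A" and R: "finite R" and y: "y \<in> span (range A \<union> R)"
  shows "\<exists>n::nat. \<exists>z\<in>operator_body A R. n > 0 \<and> y = real n *\<^sub>R z"
proof -
  obtain x c where y: "y = A x + (\<Sum>r\<in>R. scl (c r) r)"
    using y unfolding span_range_operator_Un_finite[OF A R] by blast
  \<comment> \<open>One integer dominates \<open>x\<close> and all coefficients; the strict bound
    also makes it positive.\<close>
  obtain n :: nat where n: "norm x + (\<Sum>r\<in>R. norm (c r)) < real n"
    using reals_Archimedean2 by blast
  have nn: "0 \<le> (\<Sum>r\<in>R. norm (c r))" "0 \<le> norm x" by (simp_all add: sum_nonneg)
  have "real n > 0" using n nn by linarith
  then have "n > 0" by simp
  have x: "norm x \<le> real n" using n nn by linarith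
  have c: "norm (c r) \<le> real n" if "r \<in> R" for r
  proof -
    have "norm (c r) \<le> (\<Sum>r\<in>R. norm (c r))"
      by (rule member_le_sum[OF that _ R]) simp
    then show ?thesis using n nn by linarith
  qed
  define z where "z = A ((1 / real n) *\<^sub>R x) + (\<Sum>r\<in>R. scl ((1 / real n) *\<^sub>R c r) r)"
  have "z \<in> operator_body A R"
    unfolding operator_body_def z_def using \<open>n > 0\<close> x c
    by (intro CollectI exI[of _ "(1 / real n) *\<^sub>R x"] exI[of _ "\<lambda>r. (1 / real n) *\<^sub>R c r"]) auto
  moreover have "z = (1 / real n) *\<^sub>R y"
    unfolding z_def y linear_simps(5)[OF bounded_linear_operator[OF A]] scale_scaleR_left
    by (simp add: scaleR_right_distrib scaleR_sum_right)
  ultimately show ?thesis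
    using \<open>n > 0\<close> by (intro exI[of _ n] bexI[of _ z]) auto
qed

text \<open>
  A spanning set \<open>R\<close> with as few elements outside \<open>W\<close> as possible makes each \<open>b \<in> R - W\<close>
  independent of \<open>W\<close> and the rest of \<open>R\<close>. By density, \<open>b - w\<close> lies in half the unit body for some
  \<open>w \<in> W\<close>; comparing coefficients of \<open>b\<close> gives \<open>2 = c\<close> with \<open>\<bar>c\<bar> \<le> 1\<close>.
\<close>

lemma dense_superspace_of_finite_codim_range:
  assumes A: "bounded_operator scl A" and W: "subspace W" and sub: "range A \<subseteq> W"
    and dense: "closure W = UNIV"
    and fin: "finite R\<^sub>0" "span (range A \<union> R\<^sub>0) = UNIV"
  shows "W = UNIV"
proof -
  obtain R where R: "finite R" "span (range A \<union> R) = UNIV"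
    and minimal: "\<And>R'. finite R' \<Longrightarrow> span (range A \<union> R') = UNIV \<Longrightarrow> card (R - W) \<le> card (R' - W)"
    using ex_has_least_nat[of "\<lambda>R. finite R \<and> span (range A \<union> R) = UNIV" R\<^sub>0 "\<lambda>R. card (R - W)"] fin
    by metis
  have "R \<subseteq> W"
  proof (rule ccontr)
    assume "\<not> R \<subseteq> W"
    then obtain b where b: "b \<in> R" "b \<notin> W" by blast
    \<comment> \<open>That \<open>b\<close> lies outside \<open>W'\<close> is the independence
      obtained from minimality.\<close>
    define W' where "W' = span (W \<union> (R - {b}))"
    have W': "subspace W'" "W \<subseteq> W'" "R - {b} \<subseteq> W'"
      unfolding W'_def using span_superset[of "W \<union> (R - {b})"] by auto
    have "b \<notin> W'"
    proof
      assume "b \<in> W'"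
      then obtain w v where wv: "b = w + v" "w \<in> W" "v \<in> span (R - {b})"
        unfolding W'_def span_Un span_eq_iff[THEN iffD2, OF W] by blast
      \<comment> \<open>Exchange \<open>b\<close> for \<open>w\<close>: the span stays the whole
        space, while one element fewer lies outside \<open>W\<close>.\<close>
      define R' where "R' = insert w (R - {b})"
      have "w \<in> span (range A \<union> R')" "v \<in> span (range A \<union> R')"
        using wv(3) span_mono[of "R - {b}" "range A \<union> R'"] by (auto simp: R'_def intro: span_base)
      then have "b \<in> span (range A \<union> R')"
        using wv by (simp add: span_add)
      then have "range A \<union> R \<subseteq> span (range A \<union> R')"
        by (auto simp: R'_def intro: span_base)
      then have "span (range A \<union> R') = UNIV"
        using R(2) span_minimal[OF _ subspace_span] by blast
      then have "card (R - W) \<le> card (R' - W)"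
        using R(1) by (intro minimal) (auto simp: R'_def)
      moreover have "R' - W \<subset> R - W"
        using b wv by (auto simp: R'_def)
      then have "card (R' - W) < card (R - W)"
        using R(1) by (intro psubset_card_mono) auto
      ultimately show False by simp
    qed
    obtain e where e: "e > 0" "ball 0 e \<subseteq> operator_body A R"
      using sigma_convex_absorbing_ball[OF sigma_convex_operator_body[OF A, of R]]
        operator_body_minus[OF A] operator_body_absorbing[OF A R(1)] R(2) by (metis UNIV_I)
    \<comment> \<open>Half the radius leaves room for doubling \<open>b - w\<close>, which gives
      \<open>b\<close> the coefficient 2, out of reach of \<open>c b\<close>.\<close>
    obtain w where w: "w \<in> W" "dist w b < e / 2"
      using dense e closure_approachable[of b W] by (metis UNIV_I half_gt_zero)
    then have "2 *\<^sub>R (b - w) \<in> operator_body A R"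
      using e by (intro subsetD[OF e(2)]) (simp add: dist_norm norm_minus_commute)
    then obtain x c where xc: "2 *\<^sub>R (b - w) = A x + (\<Sum>r\<in>R. scl (c r) r)" "norm (c b) \<le> 1"
      using b by (auto simp: operator_body_def)
    have "A x + (\<Sum>r\<in>R - {b}. scl (c r) r) \<in> W'"
      using W' sub by (intro subspace_add subspace_sum subspace_scale) blast+
    moreover have "2 *\<^sub>R w \<in> W'"
      using W' w scale_of_real[of 2 w] by (metis subsetD subspace_scale)
    ultimately have "A x + (\<Sum>r\<in>R - {b}. scl (c r) r) + 2 *\<^sub>R w \<in> W'"
      by (rule subspace_add[OF W'(1)])
    moreover have "A x + (\<Sum>r\<in>R - {b}. scl (c r) r) + 2 *\<^sub>R w = scl (2 - c b) b"
      using xc(1) sum.remove[OF R(1) b(1), of "\<lambda>r. scl (c r) r"] scale_of_real[of 2 b]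
      by (simp add: algebra_simps scale_left_diff_distrib)
    ultimately have "scl (2 - c b) b \<in> W'" by simp
    then have "scl (inverse (2 - c b)) (scl (2 - c b) b) \<in> W'"
      by (rule subspace_scale[OF W'(1)])
    moreover have "2 - c b \<noteq> 0"
      using xc(2) by auto
    ultimately show False
      using \<open>b \<notin> W'\<close> by simp
  qed
  then show ?thesis
    using R(2) sub span_minimal[of "range A \<union> R" W] W by auto
qed

section \<open>Dimension and codimension\<close>

lemma edim_0: "edim scl {0} = 0"
proof -
  have "dim {0} = 0"
    using dim_le_card[of "{0}" "{}"] by simp
  then show ?thesis
    by (auto simp: edim_def zero_enat_def intro!: exI[of _ "{}"])
qed

text \<open>A vector of \<open>V\<close> outside \<open>U\<close> would extend a basis of
  \<open>U\<close> to an independent set larger than a basis of \<open>V\<close>. The finite set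
  \<open>B\<close> makes both bases finite, so that \<open>dim\<close> is a true dimension.\<close>

lemma subspace_eqI_dim:
  assumes B: "finite B" "V \<subseteq> span B" and U: "subspace U" "U \<subseteq> V" and le: "dim V \<le> dim U"
  shows "U = V"
proof (rule ccontr)
  assume "U \<noteq> V"
  then obtain x where x: "x \<in> V" "x \<notin> U" using U by blast
  obtain E where E: "E \<subseteq> U" "independent E" "U \<subseteq> span E" "card E = dim U"
    using basis_exists .
  obtain F where F: "F \<subseteq> V" "independent F" "V \<subseteq> span F" "card F = dim V"
    using basis_exists .
  have fin: "finite E" "finite F"
    using independent_span_bound[OF B(1)] E F B U by (meson order_trans)+
  have "x \<notin> span E"
    using x E span_minimal[OF E(1) U(1)] by blast
  then have "independent (insert x E)" "x \<notin> E"
    using E(2) independent_insertI span_base by blast+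
  then have "card (insert x E) \<le> card F"
    using independent_span_bound[OF fin(2)] E F x U by blast
  then show False
    using \<open>x \<notin> E\<close> fin le E F by simp
qed

text \<open>The only coset is the zero of the quotient, and a basis cannot contain zero; so the
  choice in \<open>codim\<close> can only yield the empty basis.\<close>

lemma codim_UNIV: "codim scl UNIV = 0"
proof -
  have Q: "quotient_space (UNIV :: 'a set) = {UNIV}"
  proof -
    have "x +o UNIV = UNIV" for x :: 'a
      by (auto simp: elt_set_plus_def intro: exI[of _ "_ - x"])
    then show ?thesis by (simp add: quotient_space_def)
  qed
  have lin: "quotient_lincomb scl UNIV F u = UNIV" if "F \<subseteq> {UNIV}" for F u
    using quotient_lincomb_cosets[OF subspace_UNIV, of F "\<lambda>_. 0" u] that finite_subset[OF that]
    by (auto simp: elt_set_plus_def)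
  have empty: "quotient_basis scl UNIV {}"
    unfolding quotient_basis_def Q
  proof (intro conjI ballI)
    fix C :: "'a set" assume "C \<in> {UNIV}"
    then have "finite {} \<and> {} \<subseteq> {} \<and> C = quotient_lincomb scl UNIV {} (\<lambda>_. 0)"
      using lin[of "{}"] by simp
    then show "\<exists>F u. finite F \<and> F \<subseteq> {} \<and> C = quotient_lincomb scl UNIV F u"
      by blast
  qed auto
  have "B = {}" if "quotient_basis scl UNIV B" for B
  proof (rule ccontr)
    assume "B \<noteq> {}"
    moreover have "B \<subseteq> {UNIV}"
      using that[unfolded quotient_basis_def, THEN conjunct1] Q by simp
    ultimately have B: "B = {UNIV}" by blast
    have "finite B \<and> B \<subseteq> B \<and> quotient_lincomb scl UNIV B (\<lambda>_. 1) = UNIV"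
      using B lin by simp
    then have "\<forall>A\<in>B. (1::'k) = 0"
      using that[unfolded quotient_basis_def, THEN conjunct2, THEN conjunct1,
          THEN spec, THEN spec, THEN mp, of B "\<lambda>_. 1"] by simp
    then show False using B by simp
  qed
  then have "(SOME B. finite B \<and> quotient_basis scl UNIV B) = {}"
    by (intro some_equality) (auto simp: empty)
  then show ?thesis
    using empty by (auto simp: codim_def zero_enat_def)
qed

text \<open>Representatives of the cosets in a finite quotient basis, together with
  \<open>Y\<close>, generate the space. This trades cosets for vectors.\<close>

lemma codim_finiteE:
  assumes Y: "subspace Y" and "codim scl Y \<noteq> \<infinity>"
  obtains R where "finite R" "span (Y \<union> R) = UNIV"
proof -
  obtain B where B: "finite B" "quotient_basis scl Y B"
    using assms(2) by (auto simp: codim_def split: if_splits)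
  have "\<exists>r. A = r +o Y" if "A \<in> B" for A
    using B(2) that by (auto simp: quotient_basis_def quotient_space_def)
  then obtain r where r: "\<And>A. A \<in> B \<Longrightarrow> A = r A +o Y" by metis
  have "x \<in> span (Y \<union> r ` B)" for x
  proof -
    have "x +o Y \<in> quotient_space Y" by (simp add: quotient_space_def)
    then obtain F u where F: "finite F" "F \<subseteq> B" "x +o Y = quotient_lincomb scl Y F u"
      using B(2) unfolding quotient_basis_def by meson
    have "quotient_lincomb scl Y F u = (\<Sum>A\<in>F. scl (u A) (r A)) +o Y"
      by (rule quotient_lincomb_cosets[OF Y F(1)]) (rule r[OF subsetD[OF F(2)]])
    then have "x +o Y = (\<Sum>A\<in>F. scl (u A) (r A)) +o Y"
      using F(3) by simp
    moreover have "x \<in> x +o Y"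
      using subspace_0[OF Y] by (force simp: elt_set_plus_def)
    ultimately have "x \<in> (\<Sum>A\<in>F. scl (u A) (r A)) +o Y"
      by (rule subst)
    then obtain y where "y \<in> Y" "x = (\<Sum>A\<in>F. scl (u A) (r A)) + y"
      unfolding elt_set_plus_def by blast
    moreover have "r A \<in> span (Y \<union> r ` B)" if "A \<in> F" for A
      using F(2) that by (intro span_base) blast
    ultimately show ?thesis
      by (simp add: span_add span_sum span_scale span_base)
  qed
  then show thesis
    using B(1) by (intro that[of "r ` B"]) auto
qed

end

section \<open>Kernels and ranges along the semigroup\<close>

locale C0_semigroup_space = banach_space scl
  for scl :: "'k::{real_normed_field, euclidean_space} \<Rightarrow> 'a::banach \<Rightarrow> 'a" +
  fixes S :: "real \<Rightarrow> 'a \<Rightarrow> 'a"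
  assumes semigroup: "C0_semigroup scl S"
begin

lemma operator: "t \<ge> 0 \<Longrightarrow> bounded_operator scl (S t)"
  using semigroup by (simp add: C0_semigroup_def)

lemma linear: "t \<ge> 0 \<Longrightarrow> Vector_Spaces.linear scl scl (S t)"
  using operator by (simp add: bounded_operator_def)

lemma add: "s \<ge> 0 \<Longrightarrow> t \<ge> 0 \<Longrightarrow> S (s + t) x = S s (S t x)"
  using semigroup by (simp add: C0_semigroup_def)

lemma tendsto_at_0: "(\<lambda>n. S (t / real (Suc n)) x) \<longlonglongrightarrow> x" if "t \<ge> 0"
proof -
  have "(\<lambda>n. t / real (Suc n)) \<longlonglongrightarrow> 0"
    using LIMSEQ_Suc[OF lim_const_over_n[of t]] by simp
  then have "(\<lambda>n. S (t / real (Suc n)) x) \<longlonglongrightarrow> S 0 x"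
    using semigroup that unfolding C0_semigroup_def
    by (intro continuous_on_tendsto_compose[of "{0..}" "\<lambda>t. S t x"]) auto
  then show ?thesis
    using semigroup by (simp add: C0_semigroup_def)
qed

lemma subspace_range: "t \<ge> 0 \<Longrightarrow> subspace (range (S t))"
  using linear module_hom.subspace_image[OF _ subspace_UNIV]
  by (auto simp: Vector_Spaces.linear_iff_module_hom)

lemma subspace_kernel: "t \<ge> 0 \<Longrightarrow> subspace {x. S t x = 0}"
  using linear module_hom.subspace_kernel by (auto simp: Vector_Spaces.linear_iff_module_hom)

text \<open>Factor \<open>S t\<close> with \<open>S s\<close> applied last; for kernels, below,
  \<open>S s\<close> is applied first.\<close>

lemma range_antimono: "range (S t) \<subseteq> range (S s)" if "0 \<le> s" "s \<le> t"
  using add[of s "t - s"] that by auto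

lemma kernel_mono: "{x. S s x = 0} \<subseteq> {x. S t x = 0}" if "0 \<le> s" "s \<le> t"
proof -
  have "S (t - s) 0 = 0"
    using subspace_0[OF subspace_kernel, of "t - s"] that by simp
  then show ?thesis
    using add[of "t - s" s] that by auto
qed

text \<open>Passes from a small time to a time beyond 1, from which monotonicity of the ranges leads
  back to 1.\<close>

lemma surj_multiple: "surj (S t) \<Longrightarrow> t \<ge> 0 \<Longrightarrow> surj (S (real n * t))"
proof (induction n)
  case 0
  then show ?case using semigroup by (simp add: C0_semigroup_def)
next
  case (Suc n)
  have "S (real (Suc n) * t) = S t \<circ> S (real n * t)"
    using Suc.prems add[of t "real n * t"] by (auto simp: algebra_simps)
  then show ?case using Suc by (metis comp_surj)
qed

lemma kernel_trivial_multiple: "{x. S t x = 0} = {0} \<Longrightarrow> t \<ge> 0 \<Longrightarrow> {x. S (real n * t) x = 0} = {0}"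
proof (induction n)
  case 0
  then show ?case using semigroup by (simp add: C0_semigroup_def)
next
  case (Suc n)
  have "S (real (Suc n) * t) x = S t (S (real n * t) x)" for x
    using Suc.prems add[of t "real n * t"] by (auto simp: algebra_simps)
  then show ?case using Suc by auto
qed

lemma edim_kernel: "edim scl {x. S 1 x = 0} = 0 \<or> edim scl {x. S 1 x = 0} = \<infinity>"
proof (rule disjCI)
  define K where "K t = {x. S t x = 0}" for t
  assume "edim scl {x. S 1 x = 0} \<noteq> \<infinity>"
  then obtain B where B: "finite B" "K 1 \<subseteq> span B"
    by (auto simp: edim_def K_def split: if_splits)
  \<comment> \<open>Kernel dimensions are natural numbers, so some time in the interval attains the
    least one; before that time the kernels cannot shrink further.\<close>
  obtain t where t: "0 < t" "t \<le> 1"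
    and minimal: "\<And>s. 0 < s \<Longrightarrow> s \<le> 1 \<Longrightarrow> dim (K t) \<le> dim (K s)"
    using ex_has_least_nat[of "\<lambda>t::real. 0 < t \<and> t \<le> 1" 1 "\<lambda>t. dim (K t)"] by auto
  have K_eq: "K s = K t" if "0 < s" "s \<le> t" for s
  proof (rule subspace_eqI_dim[OF B(1)])
    show "K t \<subseteq> span B" using kernel_mono[of t 1] t B(2) by (auto simp: K_def)
    show "subspace (K s)" "K s \<subseteq> K t"
      using that subspace_kernel kernel_mono[of s t] by (auto simp: K_def)
    show "dim (K t) \<le> dim (K s)" using minimal that t by simp
  qed
  have "x = 0" if "x \<in> K t" for x
  proof -
    have "S (t / real (Suc n)) x = 0" for n
    proof -
      have "t / real (Suc n) \<le> t" using t by (simp add: field_simps)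
      then have "x \<in> K (t / real (Suc n))" using K_eq[of "t / real (Suc n)"] t that by simp
      then show ?thesis by (simp add: K_def)
    qed
    \<comment> \<open>The zero sequence converges to \<open>x\<close> by strong continuity.\<close>
    then show ?thesis
      using tendsto_at_0[of t x] t by (simp add: LIMSEQ_const_iff)
  qed
  then have "K t = {0}"
    using subspace_0[OF subspace_kernel, of t] t by (auto simp: K_def)
  moreover obtain n :: nat where "1 < real n * t"
    using reals_Archimedean3[OF t(1)] by blast
  ultimately have "K 1 \<subseteq> {0}"
    using kernel_trivial_multiple[of t n] kernel_mono[of 1 "real n * t"] t by (auto simp: K_def)
  then have "K 1 = {0}"
    using subspace_0[OF subspace_kernel, of 1] by (auto simp: K_def)
  then show "edim scl {x. S 1 x = 0} = 0"
    using edim_0 by (simp add: K_def)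
qed

lemma codim_range: "codim scl (range (S 1)) = 0 \<or> codim scl (range (S 1)) = \<infinity>"
proof (rule disjCI)
  assume "codim scl (range (S 1)) \<noteq> \<infinity>"
  then obtain R where R: "finite R" "span (range (S 1) \<union> R) = UNIV"
    using codim_finiteE[OF subspace_range] by (metis zero_le_one)
  define Z where "Z = (\<Union>t\<in>{0<..1}. range (S t))"
  have "subspace Z"
  proof (rule subspaceI)
    show "0 \<in> Z"
      using subspace_0[OF subspace_range, of 1] by (auto simp: Z_def intro!: bexI[of _ 1])
    fix x assume "x \<in> Z"
    then obtain s where s: "0 < s" "s \<le> 1" "x \<in> range (S s)" by (auto simp: Z_def)
    show "scl c x \<in> Z" for c
      using subspace_scale[OF subspace_range s(3), of c] s by (auto simp: Z_def intro!: bexI[of _ s])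
    fix y assume "y \<in> Z"
    then obtain t where t: "0 < t" "t \<le> 1" "y \<in> range (S t)" by (auto simp: Z_def)
    \<comment> \<open>The ranges are nested, so both vectors lie in the range at the earlier
      time.\<close>
    have "x \<in> range (S (min s t))" "y \<in> range (S (min s t))"
      using s t range_antimono[of "min s t" s] range_antimono[of "min s t" t] by auto
    then have "x + y \<in> range (S (min s t))"
      using s t by (intro subspace_add subspace_range) auto
    then show "x + y \<in> Z"
      using s t by (auto simp: Z_def intro!: bexI[of _ "min s t"])
  qed
  moreover have S1: "bounded_operator scl (S 1)" by (rule operator) simp
  moreover have "range (S 1) \<subseteq> Z" by (auto simp: Z_def intro!: bexI[of _ 1])
  moreover have closure: "x \<in> closure Z" for x
  proof -
    have "S (1 / real (Suc n)) x \<in> Z" for n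
      unfolding Z_def by (rule UN_I[of "1 / real (Suc n)"]) auto
    then show ?thesis
      unfolding closure_sequential using tendsto_at_0[of 1 x]
      by (intro exI[of _ "\<lambda>n. S (1 / real (Suc n)) x"]) simp
  qed
  moreover have "closure Z = UNIV" using closure by blast
  ultimately have Z: "Z = UNIV"
    using R by (metis dense_superspace_of_finite_codim_range)
  \<comment> \<open>Finiteness of \<open>R\<close> gives a common positive time, as a minimum of
    finitely many.\<close>
  have "\<exists>t\<in>{0<..1}. R \<subseteq> range (S t)"
    using R(1)
  proof (induction R)
    case empty
    then show ?case by (intro bexI[of _ 1]) auto
  next
    case (insert r R)
    then obtain t where t: "0 < t" "t \<le> 1" "R \<subseteq> range (S t)" by auto
    have "r \<in> Z" using Z by simp
    then obtain s where s: "0 < s" "s \<le> 1" "r \<in> range (S s)" by (auto simp: Z_def)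
    show ?case
      using s t range_antimono[of "min s t" s] range_antimono[of "min s t" t]
      by (intro bexI[of _ "min s t"]) auto
  qed
  then obtain t where t: "0 < t" "t \<le> 1" "R \<subseteq> range (S t)" by auto
  \<comment> \<open>As \<open>t\<close> is at most 1, the range at time \<open>t\<close> contains
    \<open>range (S 1)\<close> as well as \<open>R\<close>, hence everything.\<close>
  have "span (range (S 1) \<union> R) \<subseteq> range (S t)"
    using t range_antimono[of t 1] by (intro span_minimal subspace_range) auto
  then have "surj (S t)" using R(2) by auto
  moreover obtain n :: nat where "1 < real n * t"
    using reals_Archimedean3[OF t(1)] by blast
  ultimately have "range (S 1) = UNIV"
    using surj_multiple[of t n] range_antimono[of 1 "real n * t"] t by auto
  then show "codim scl (range (S 1)) = 0"
    using codim_UNIV by simp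
qed

end

theorem theorem3p1:
  fixes scl :: "'k::{real_normed_field, euclidean_space} \<Rightarrow> 'a::banach \<Rightarrow> 'a"
    and T :: "'a \<Rightarrow> 'a"
  assumes "banach_space scl"
    and "bounded_operator scl T"
    and "embeddable scl T"
  shows "(edim scl {x. T x = 0} = 0 \<or> edim scl {x. T x = 0} = \<infinity>) \<and>
    (codim scl (range T) = 0 \<or> codim scl (range T) = \<infinity>)"
proof -
  obtain S where S: "C0_semigroup scl S" "T = S 1"
    using assms(3) by (auto simp: embeddable_def)
  then interpret C0_semigroup_space scl S
    using assms(1) by (simp add: C0_semigroup_space_def C0_semigroup_space_axioms_def)
  show ?thesis
    using edim_kernel codim_range by (simp add: S)
qed

end
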